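(* Let $(Y,\tau)$ be a topological space and $(Z,\mathcal{U})$ a uniform space. Then the point-transitive-entourage topology on $EC(Y,Z)$ is splitting.
   Context: Uniform spaces $(Z,\mathcal{U})$ are given in the usual sense by a family $\mathcal{U}$ of entourages on a non-empty set $Z$. For $U\in\mathcal{U}$ and $z\in Z$, $U[z]=\{w\in Z : (z,w)\in U\}$. Equi-continuity: a function $f:(X,\tau)\to(Z,\mathcal{U})$ from a topological space to a uniform space is equi-continuous at $x\in X$ if for each $U\in\mathcal{U}$ there is an open neighbourhood $V$ of $x$ with $f(V)\subseteq U[f(x)]$; it is equi-continuous if this holds at all $x\in X$. $EC(Y,Z)$ is the set of all equi-continuous functions from $Y$ to $Z$. Point-transitive-entourage topology: an entourage $U_t\in\mathcal{U}$ is transitive if $U_t\circ U_t\subseteq U_t$. The point-transitive-entourage topology is the topology on $EC(Y,Z)$ generated by the subbasis consisting of the sets $(y,U_t)_z=\{f\in EC(Y,Z) : f(y)\in U_t[z]\}$, for $z\in Z$, $y\in Y$ and transitive entourages $U_t\in\mathcal{U}$. Associated maps: for a topological space $X$, maps $g:X\times Y\to Z$ and $g^*:X\to EC(Y,Z)$ are associated if $g^*(x)(y)=g(x,y)$ for all $x\in X$, $y\in Y$ (if $g$ is equi-continuous on the product space $X\times Y$, each $g(x,\cdot)$ lies in $EC(Y,Z)$). Splitting: a topology $\mathfrak{T}$ on $EC(Y,Z)$ is splitting if for each topological space $(X,\mu)$, equi-continuity of a map $g:X\times Y\to Z$ implies continuity of its associated map $g^*:X\to (EC(Y,Z),\mathfrak{T})$.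 *)

theory Defs
  imports "HOL-Analysis.Analysis"
begin

text \<open>
  The uniform space \<open>Z\<close> is a type of class \<open>uniform_space\<close>, whose uniformity is a filter on
  pairs; its entourages are the members of that filter. The spaces \<open>X\<close> and \<open>Y\<close> are
  abstract topologies with an explicit (possibly empty) carrier.
\<close>

definition entourages :: "('z::uniform_space \<times> 'z) set set" where
  "entourages = {U. eventually (\<lambda>p. p \<in> U) uniformity}"

definition transitive_entourages :: "('z::uniform_space \<times> 'z) set set" where
  "transitive_entourages = {U \<in> entourages. U O U \<subseteq> U}"

definition equicontinuous_at :: "'a topology \<Rightarrow> ('a \<Rightarrow> 'z::uniform_space) \<Rightarrow> 'a \<Rightarrow> bool" where
  "equicontinuous_at T f x \<longleftrightarrow>
     (\<forall>U \<in> entourages. \<exists>V. openin T V \<and> x \<in> V \<and> f ` V \<subseteq> U `` {f x})"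

definition equicontinuous :: "'a topology \<Rightarrow> ('a \<Rightarrow> 'z::uniform_space) \<Rightarrow> bool" where
  "equicontinuous T f \<longleftrightarrow> (\<forall>x \<in> topspace T. equicontinuous_at T f x)"

text \<open>
  Functions are taken extensional on the carrier of \<open>Y\<close>, so that elements of \<open>EC Y\<close> are
  equal iff they agree on that carrier.
\<close>

definition EC :: "'y topology \<Rightarrow> ('y \<Rightarrow> 'z::uniform_space) set" where
  "EC Y = {f \<in> extensional (topspace Y). equicontinuous Y f}"

definition point_entourage_set ::
    "'y topology \<Rightarrow> 'y \<Rightarrow> ('z::uniform_space \<times> 'z) set \<Rightarrow> 'z \<Rightarrow> ('y \<Rightarrow> 'z) set" where
  "point_entourage_set Y y U z = {f \<in> EC Y. f y \<in> U `` {z}}"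

definition point_transitive_entourage_subbasis ::
    "'y topology \<Rightarrow> ('y \<Rightarrow> 'z::uniform_space) set set" where
  "point_transitive_entourage_subbasis Y =
     {point_entourage_set Y y U z | y U z. y \<in> topspace Y \<and> U \<in> transitive_entourages}"

text \<open>
  Open sets are unions of finite intersections of subbasic sets, the empty intersection being
  \<open>EC Y\<close>. The constant \<open>topology_generated_by\<close> would instead give the empty carrier when
  the carrier of \<open>Y\<close>, and hence the subbasis, is empty.
\<close>

definition point_transitive_entourage_topology ::
    "'y topology \<Rightarrow> ('y \<Rightarrow> 'z::uniform_space) topology" where
  "point_transitive_entourage_topology Y =
     topology (arbitrary union_of
       (finite intersection_of (\<lambda>S. S \<in> point_transitive_entourage_subbasis Y) relative_to EC Y))"

definition associated_map :: "'y topology \<Rightarrow> ('x \<times> 'y \<Rightarrow> 'z) \<Rightarrow> 'x \<Rightarrow> 'y \<Rightarrow> 'z" where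
  "associated_map Y g x = (\<lambda>y \<in> topspace Y. g (x, y))"

text \<open>
  HOL cannot quantify over types inside a formula, so the type of points of the test spaces
  \<open>X\<close> is a parameter; a theorem with this type left free holds for every test space.
\<close>

definition splitting ::
    "'x itself \<Rightarrow> 'y topology \<Rightarrow> ('y \<Rightarrow> 'z::uniform_space) topology \<Rightarrow> bool" where
  "splitting _ Y T \<longleftrightarrow> topspace T = EC Y \<and>
     (\<forall>(X :: 'x topology) g. equicontinuous (prod_topology X Y) g \<longrightarrow>
        continuous_map X T (associated_map Y g))"

end

theory Submission
  imports Defs
begin

text \<open>Continuity into a topology given by a subbasis need only be tested on subbasic sets. The
  preimage of \<open>point_entourage_set Y y U z\<close> under the associated map is the set of
  \<open>x\<close> with \<open>g (x, y)\<close> in \<open>U[z]\<close>. The slice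
  \<open>g (_, y)\<close> is equicontinuous (\<open>equicontinuous_compose\<close>), and
  transitivity of \<open>U\<close> makes \<open>U[z]\<close> contain \<open>U[w]\<close> for each of
  its points \<open>w\<close>, so this preimage is open
  (\<open>openin_preimage_transitive_entourage\<close>). The other slices \<open>g (x, _)\<close>
  place the associated map in \<open>EC Y\<close> (\<open>associated_map_in_EC\<close>).\<close>

lemma equicontinuous_compose:
  fixes f :: "'b \<Rightarrow> 'z::uniform_space"
  assumes h: "continuous_map S T h" and f: "equicontinuous T f"
  shows "equicontinuous S (\<lambda>x. f (h x))"
  unfolding equicontinuous_def equicontinuous_at_def
proof (intro ballI)
  fix x and U :: "('z \<times> 'z) set" assume x: "x \<in> topspace S" and U: "U \<in> entourages"
  have "h x \<in> topspace T"
    using continuous_map_funspace[OF h] x by auto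
  then obtain V where V: "openin T V" "h x \<in> V" "f ` V \<subseteq> U `` {f (h x)}"
    using f U unfolding equicontinuous_def equicontinuous_at_def by meson
  have "openin S {x \<in> topspace S. h x \<in> V}"
    using h V(1) by (rule openin_continuous_map_preimage)
  then show "\<exists>W. openin S W \<and> x \<in> W \<and> (\<lambda>x. f (h x)) ` W \<subseteq> U `` {f (h x)}"
    using V x by (intro exI[of _ "{x \<in> topspace S. h x \<in> V}"]) auto
qed

text \<open>Bridges the gap between \<open>g (x, _)\<close> and its restriction to the carrier of
  \<open>Y\<close>, which may differ off that carrier.\<close>

lemma equicontinuous_cong:
  fixes f g :: "'a \<Rightarrow> 'z::uniform_space"
  assumes "\<And>x. x \<in> topspace T \<Longrightarrow> f x = g x" and f: "equicontinuous T f"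
  shows "equicontinuous T g"
  unfolding equicontinuous_def equicontinuous_at_def
proof (intro ballI)
  fix x and U :: "('z \<times> 'z) set" assume x: "x \<in> topspace T" and U: "U \<in> entourages"
  then obtain V where V: "openin T V" "x \<in> V" "f ` V \<subseteq> U `` {f x}"
    using f unfolding equicontinuous_def equicontinuous_at_def by meson
  have "g ` V = f ` V"
    using openin_subset[OF V(1)] assms(1) by (intro image_cong) auto
  then show "\<exists>V. openin T V \<and> x \<in> V \<and> g ` V \<subseteq> U `` {g x}"
    using V assms(1)[OF x] by (intro exI[of _ V]) simp
qed

text \<open>For a general entourage \<open>U[z]\<close> need not be open. If \<open>U\<close> is
  transitive and \<open>f x\<close> lies in \<open>U[z]\<close>, then \<open>U[f x]\<close> is
  contained in \<open>U[z]\<close>, so the neighbourhood of \<open>x\<close> that equicontinuity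
  provides for \<open>U\<close> itself stays in the preimage.\<close>

lemma openin_preimage_transitive_entourage:
  assumes f: "equicontinuous T f" and U: "U \<in> transitive_entourages"
  shows "openin T {x \<in> topspace T. f x \<in> U `` {z}}"
proof (subst openin_subopen, intro ballI)
  fix x assume x: "x \<in> {x \<in> topspace T. f x \<in> U `` {z}}"
  have "U \<in> entourages" and trans: "U O U \<subseteq> U"
    using U by (auto simp: transitive_entourages_def)
  then obtain V where V: "openin T V" "x \<in> V" "f ` V \<subseteq> U `` {f x}"
    using f x unfolding equicontinuous_def equicontinuous_at_def by (metis (lifting) mem_Collect_eq)
  have "f v \<in> U `` {z}" if "v \<in> V" for v
  proof -
    have "(z, f x) \<in> U" and "(f x, f v) \<in> U"
      using x V(3) that by auto
    then show ?thesis
      using trans by auto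
  qed
  then have "V \<subseteq> {x \<in> topspace T. f x \<in> U `` {z}}"
    using openin_subset[OF V(1)] by auto
  with V show "\<exists>V. openin T V \<and> x \<in> V \<and> V \<subseteq> {x \<in> topspace T. f x \<in> U `` {z}}"
    by blast
qed

lemma associated_map_in_EC:
  assumes g: "equicontinuous (prod_topology X Y) g" and x: "x \<in> topspace X"
  shows "associated_map Y g x \<in> EC Y"
proof -
  have "continuous_map Y (prod_topology X Y) (\<lambda>y. (x, y))"
    using x by (simp add: continuous_map_paired)
  then have "equicontinuous Y (\<lambda>y. g (x, y))"
    using g by (rule equicontinuous_compose)
  then have "equicontinuous Y (associated_map Y g x)"
    by (rule equicontinuous_cong[rotated]) (simp add: associated_map_def)
  then show ?thesis
    by (simp add: EC_def associated_map_def)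
qed

theorem theorem4p11:
  fixes Y :: "'y topology"
  shows "splitting TYPE('x) Y
    (point_transitive_entourage_topology Y :: ('y \<Rightarrow> 'z::uniform_space) topology)"
  unfolding splitting_def
proof (intro conjI allI impI)
  \<comment> \<open>The empty intersection relative to \<open>EC Y\<close> is \<open>EC Y\<close>
    itself, so the carrier is right even for empty \<open>Y\<close>.\<close>
  show "topspace (point_transitive_entourage_topology Y) = (EC Y :: ('y \<Rightarrow> 'z) set)"
    by (simp add: point_transitive_entourage_topology_def)
next
  fix X :: "'x topology" and g :: "'x \<times> 'y \<Rightarrow> 'z"
  assume g: "equicontinuous (prod_topology X Y) g"
  show "continuous_map X (point_transitive_entourage_topology Y) (associated_map Y g)"
    unfolding point_transitive_entourage_topology_def
  proof (rule continuous_map_into_topology_subbase)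
    fix S :: "('y \<Rightarrow> 'z) set"
    assume "S \<in> point_transitive_entourage_subbasis Y"
    then obtain y U z where S: "S = point_entourage_set Y y U z"
      and y: "y \<in> topspace Y" and U: "U \<in> transitive_entourages"
      by (auto simp: point_transitive_entourage_subbasis_def)
    have "continuous_map X (prod_topology X Y) (\<lambda>x. (x, y))"
      using y by (simp add: continuous_map_paired)
    then have "equicontinuous X (\<lambda>x. g (x, y))"
      using g by (rule equicontinuous_compose)
    then have "openin X {x \<in> topspace X. g (x, y) \<in> U `` {z}}"
      using U by (rule openin_preimage_transitive_entourage)
    \<comment> \<open>The condition of lying in \<open>EC Y\<close>, built into \<open>S\<close>,
      holds automatically on \<open>topspace X\<close>; since \<open>y\<close> is in the carrier,
      restriction does not alter the value there.\<close>
    moreover have "{x \<in> topspace X. associated_map Y g x \<in> S}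
        = {x \<in> topspace X. g (x, y) \<in> U `` {z}}"
      using associated_map_in_EC[OF g] y
      by (auto simp: S point_entourage_set_def associated_map_def)
    ultimately show "openin X {x \<in> topspace X. associated_map Y g x \<in> S}"
      by simp
  qed (simp add: associated_map_in_EC[OF g])
qed

end
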